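(* Fix $m=(p,q)\in\mathcal M$. Assume $P(A_m(Z)>0)=1$, $P(B_m(Z)>0)=1$, and $P(A_m(Z)B_m(Z)>0)>0$. Then $\alpha\mapsto H_\alpha(m)$ is continuous and strictly increasing on $(0,2)$, with $$\lim_{\alpha\downarrow0}H_\alpha(m)=-1,\qquad\lim_{\alpha\uparrow2}H_\alpha(m)=1.$$ Consequently, there exists a unique $\alpha(m)\in(0,2)$ satisfying $H_{\alpha(m)}(m)=0$.
   Context: $(M,g_M)$ and $(N,g_N)$ are smooth, connected, complete Riemannian manifolds with geodesic distances $d_M,d_N$, $\mathcal M=M\times N$, and $Z=(X,Y)$ is a random element of $\mathcal M$ with distribution $P$. For $m=(p,q)$ put $A_m(Z)=d_M(p,X)^2$, $B_m(Z)=d_N(q,Y)^2$, and for $\alpha\in(0,2)$ let $h_\alpha(Z;m)=\dfrac{\alpha A_m(Z)-(2-\alpha)B_m(Z)}{\alpha A_m(Z)+(2-\alpha)B_m(Z)}$ and $H_\alpha(m)=E[h_\alpha(Z;m)]$. *)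

theory Defs
  imports "HOL-Probability.Probability"
begin

text \<open>
  Smooth manifolds are not available in the libraries, so Riemannian manifolds are defined here
  by an atlas together with the components of the metric tensor in each chart. The underlying
  topological space is a type in the classes \<^class>\<open>t2_space\<close> and
  \<^class>\<open>second_countable_topology\<close>; no metric on the type is assumed, the geodesic distance
  being derived from the metric tensor.
\<close>

subsection \<open>Smooth functions on open sets\<close>

primrec Ck_on :: "nat \<Rightarrow> ('a::euclidean_space \<Rightarrow> 'b::real_normed_vector) \<Rightarrow> 'a set \<Rightarrow> bool" where
  "Ck_on 0 f S \<longleftrightarrow> continuous_on S f"
| "Ck_on (Suc k) f S \<longleftrightarrow>
     (\<forall>x\<in>S. f differentiable (at x)) \<and> (\<forall>v. Ck_on k (\<lambda>x. frechet_derivative f (at x) v) S)"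

definition smooth_on :: "('a::euclidean_space \<Rightarrow> 'b::real_normed_vector) \<Rightarrow> 'a set \<Rightarrow> bool" where
  "smooth_on f S \<longleftrightarrow> (\<forall>k. Ck_on k f S)"

subsection \<open>Smooth manifolds and Riemannian metrics\<close>

text \<open>A chart is a pair of its domain and its coordinate map.\<close>

type_synonym ('m, 'e) chart = "'m set \<times> ('m \<Rightarrow> 'e)"

definition is_chart :: "('m::topological_space, 'e::euclidean_space) chart \<Rightarrow> bool" where
  "is_chart c \<longleftrightarrow> (case c of (U, \<phi>) \<Rightarrow>
     open U \<and> open (\<phi> ` U) \<and> homeomorphism U (\<phi> ` U) \<phi> (inv_into U \<phi>))"

definition transition :: "('m, 'e) chart \<Rightarrow> ('m, 'e) chart \<Rightarrow> 'e \<Rightarrow> 'e" where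
  "transition c c' = snd c' \<circ> inv_into (fst c) (snd c)"

definition smooth_atlas ::
  "('m::{t2_space,second_countable_topology}, 'e::euclidean_space) chart set \<Rightarrow> bool" where
  "smooth_atlas \<A> \<longleftrightarrow>
     (\<forall>c\<in>\<A>. is_chart c) \<and>
     (\<Union>c\<in>\<A>. fst c) = UNIV \<and>
     (\<forall>c\<in>\<A>. \<forall>c'\<in>\<A>. smooth_on (transition c c') (snd c ` (fst c \<inter> fst c')))"

text \<open>
  The number \<open>g c x u v\<close> is the inner product, in the tangent space at \<open>x\<close>, of the tangent
  vectors whose coordinates in the chart \<open>c\<close> are \<open>u\<close> and \<open>v\<close>.
\<close>

type_synonym ('m, 'e) metric_tensor = "('m, 'e) chart \<Rightarrow> 'm \<Rightarrow> 'e \<Rightarrow> 'e \<Rightarrow> real"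

definition riemannian_metric ::
  "('m, 'e::euclidean_space) chart set \<Rightarrow> ('m, 'e) metric_tensor \<Rightarrow> bool" where
  "riemannian_metric \<A> g \<longleftrightarrow>
     (\<forall>c\<in>\<A>. \<forall>x\<in>fst c. bilinear (g c x) \<and>
        (\<forall>u v. g c x u v = g c x v u) \<and> (\<forall>u. u \<noteq> 0 \<longrightarrow> g c x u u > 0)) \<and>
     (\<forall>c\<in>\<A>. \<forall>u v. smooth_on (\<lambda>y. g c (inv_into (fst c) (snd c) y) u v) (snd c ` fst c)) \<and>
     (\<forall>c\<in>\<A>. \<forall>c'\<in>\<A>. \<forall>x\<in>fst c \<inter> fst c'. \<forall>u v.
        g c x u v = g c' x (frechet_derivative (transition c c') (at (snd c x)) u)
                           (frechet_derivative (transition c c') (at (snd c x)) v))"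

subsection \<open>Geodesic distance\<close>

definition C1_curve_on ::
  "('m, 'e::euclidean_space) chart set \<Rightarrow> real set \<Rightarrow> (real \<Rightarrow> 'm) \<Rightarrow> bool" where
  "C1_curve_on \<A> I \<gamma> \<longleftrightarrow> (\<forall>c\<in>\<A>. \<exists>D.
     continuous_on {t\<in>I. \<gamma> t \<in> fst c} D \<and>
     (\<forall>t\<in>{t\<in>I. \<gamma> t \<in> fst c}. ((snd c \<circ> \<gamma>) has_vector_derivative D t) (at t within {t\<in>I. \<gamma> t \<in> fst c})))"

text \<open>
  The set \<open>S\<close> contains the break points. Requiring \<open>C\<^sup>1\<close> on closed subintervals, with one-sided
  derivatives at their end points, makes the speed bounded and hence the length finite.
\<close>

definition piecewise_C1_curve ::
  "('m::topological_space, 'e::euclidean_space) chart set \<Rightarrow> (real \<Rightarrow> 'm) \<Rightarrow> bool" where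
  "piecewise_C1_curve \<A> \<gamma> \<longleftrightarrow> continuous_on {0..1} \<gamma> \<and>
     (\<exists>S. finite S \<and> (\<forall>a b. 0 \<le> a \<and> a < b \<and> b \<le> 1 \<and> {a<..<b} \<inter> S = {} \<longrightarrow> C1_curve_on \<A> {a..b} \<gamma>))"

text \<open>
  At every \<open>t\<close> that is not a break point, the speed does not depend on the selected chart, by
  the transformation rule of the metric tensor.
\<close>

definition curve_speed ::
  "('m, 'e::euclidean_space) chart set \<Rightarrow> ('m, 'e) metric_tensor \<Rightarrow> (real \<Rightarrow> 'm) \<Rightarrow> real \<Rightarrow> real" where
  "curve_speed \<A> g \<gamma> t =
     (let c = (SOME c. c \<in> \<A> \<and> \<gamma> t \<in> fst c);
          w = vector_derivative (snd c \<circ> \<gamma>) (at t within {0..1})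
      in sqrt (g c (\<gamma> t) w w))"

definition curve_length ::
  "('m, 'e::euclidean_space) chart set \<Rightarrow> ('m, 'e) metric_tensor \<Rightarrow> (real \<Rightarrow> 'm) \<Rightarrow> real" where
  "curve_length \<A> g \<gamma> = integral {0..1} (curve_speed \<A> g \<gamma>)"

definition geodesic_dist ::
  "('m::topological_space, 'e::euclidean_space) chart set \<Rightarrow> ('m, 'e) metric_tensor \<Rightarrow> 'm \<Rightarrow> 'm \<Rightarrow> real" where
  "geodesic_dist \<A> g x y =
     Inf {curve_length \<A> g \<gamma> |\<gamma>. piecewise_C1_curve \<A> \<gamma> \<and> \<gamma> 0 = x \<and> \<gamma> 1 = y}"

definition complete_riemannian_manifold ::
  "('m::{t2_space,second_countable_topology}, 'e::euclidean_space) chart set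
    \<Rightarrow> ('m, 'e) metric_tensor \<Rightarrow> bool" where
  "complete_riemannian_manifold \<A> g \<longleftrightarrow>
     smooth_atlas \<A> \<and> riemannian_metric \<A> g \<and> connected (UNIV :: 'm set) \<and>
     Metric_space.mcomplete UNIV (geodesic_dist \<A> g)"

subsection \<open>The functions of the pair of squared distances\<close>

definition sq_dist_fst :: "('m \<Rightarrow> 'm \<Rightarrow> real) \<Rightarrow> 'm \<times> 'n \<Rightarrow> 'm \<times> 'n \<Rightarrow> real" where
  "sq_dist_fst d\<^sub>M m z = (d\<^sub>M (fst m) (fst z))\<^sup>2"

definition sq_dist_snd :: "('n \<Rightarrow> 'n \<Rightarrow> real) \<Rightarrow> 'm \<times> 'n \<Rightarrow> 'm \<times> 'n \<Rightarrow> real" where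
  "sq_dist_snd d\<^sub>N m z = (d\<^sub>N (snd m) (snd z))\<^sup>2"

definition h_balance ::
  "('m \<Rightarrow> 'm \<Rightarrow> real) \<Rightarrow> ('n \<Rightarrow> 'n \<Rightarrow> real) \<Rightarrow> real \<Rightarrow> 'm \<times> 'n \<Rightarrow> 'm \<times> 'n \<Rightarrow> real" where
  "h_balance d\<^sub>M d\<^sub>N \<alpha> z m =
     (\<alpha> * sq_dist_fst d\<^sub>M m z - (2 - \<alpha>) * sq_dist_snd d\<^sub>N m z) /
     (\<alpha> * sq_dist_fst d\<^sub>M m z + (2 - \<alpha>) * sq_dist_snd d\<^sub>N m z)"

definition H_balance ::
  "('m \<Rightarrow> 'm \<Rightarrow> real) \<Rightarrow> ('n \<Rightarrow> 'n \<Rightarrow> real) \<Rightarrow> 'w measure \<Rightarrow> ('w \<Rightarrow> 'm \<times> 'n) \<Rightarrow> real \<Rightarrow> 'm \<times> 'n \<Rightarrow> real" where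
  "H_balance d\<^sub>M d\<^sub>N W Z \<alpha> m = (\<integral>\<omega>. h_balance d\<^sub>M d\<^sub>N \<alpha> (Z \<omega>) m \<partial>W)"

end

theory Submission
  imports Defs
begin

text \<open>
  For positive \<open>A\<close> and \<open>B\<close> the quotient \<open>(\<alpha> A - (2 - \<alpha>) B) / (\<alpha> A + (2 - \<alpha>) B)\<close> is continuous and
  strictly increasing in \<open>\<alpha>\<close> on the closed interval from 0 to 2, runs from \<open>-1\<close> to \<open>1\<close>, and is bounded
  by 1 in absolute value. Dominated convergence and integration of the strict inequality transfer
  this to the expectation, and the intermediate value theorem gives the zero.

  All of this needs \<open>\<omega> \<mapsto> d(p, X \<omega>)\<close> to be measurable. It suffices that \<open>d(p, _)\<close> is upper
  semicontinuous: a curve from \<open>p\<close> to \<open>y\<close> of length less than \<open>a\<close> can be prolonged to every point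
  near \<open>y\<close> by a coordinate segment, whose length is controlled by a local bound on the
  components of the metric tensor.
\<close>

subsection \<open>Measurability of the geodesic distance\<close>

lemma chart_facts:
  assumes "smooth_atlas \<A>" "c \<in> \<A>"
  shows open_chart_domain: "open (fst c)"
    and open_chart_image: "open (snd c ` fst c)"
    and inj_on_chart: "inj_on (snd c) (fst c)"
    and continuous_on_chart_inverse: "continuous_on (snd c ` fst c) (inv_into (fst c) (snd c))"
    and continuous_on_chart: "continuous_on (fst c) (snd c)"
proof -
  have "is_chart c"
    using assms by (auto simp: smooth_atlas_def)
  then have *: "open (fst c)" "open (snd c ` fst c)"
    "homeomorphism (fst c) (snd c ` fst c) (snd c) (inv_into (fst c) (snd c))"
    by (auto simp: is_chart_def case_prod_beta)
  then show "open (fst c)" "open (snd c ` fst c)"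
    by auto
  from *(3) show "inj_on (snd c) (fst c)"
    by (metis homeomorphism_apply1 inj_on_inverseI)
  from *(3) show "continuous_on (snd c ` fst c) (inv_into (fst c) (snd c))" "continuous_on (fst c) (snd c)"
    by (auto simp: homeomorphism_def)
qed

lemma chart_at_exists:
  assumes "smooth_atlas \<A>"
  obtains c where "c \<in> \<A>" "x \<in> fst c"
  using assms unfolding smooth_atlas_def by blast

lemma transition_derivative:
  assumes A: "smooth_atlas \<A>" and c: "c \<in> \<A>" "c' \<in> \<A>"
  shows "x \<in> fst c \<inter> fst c' \<Longrightarrow>
      (transition c c' has_derivative frechet_derivative (transition c c') (at (snd c x))) (at (snd c x))"
    and "continuous_on (snd c ` (fst c \<inter> fst c')) (\<lambda>y. frechet_derivative (transition c c') (at y) v)"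
proof -
  have "Ck_on (Suc 0) (transition c c') (snd c ` (fst c \<inter> fst c'))"
    using A c unfolding smooth_atlas_def smooth_on_def by blast
  then show "x \<in> fst c \<inter> fst c' \<Longrightarrow>
      (transition c c' has_derivative frechet_derivative (transition c c') (at (snd c x))) (at (snd c x))"
    and "continuous_on (snd c ` (fst c \<inter> fst c')) (\<lambda>y. frechet_derivative (transition c c') (at y) v)"
    by (auto simp: frechet_derivative_works)
qed

lemma isCont_open_nhd:
  assumes "isCont f t" "open U" "f t \<in> U"
  obtains T where "open T" "t \<in> T" "\<And>s. s \<in> T \<Longrightarrow> f s \<in> U"
  using assms by (metis continuous_at_open)

lemma curve_speed_eq:
  assumes A: "smooth_atlas \<A>" and g: "riemannian_metric \<A> g"
    and c: "c \<in> \<A>" "\<gamma> t \<in> fst c" and t: "0 < t" "t < 1"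
    and cont: "isCont \<gamma> t"
    and w: "((snd c \<circ> \<gamma>) has_vector_derivative w) (at t)"
  shows "curve_speed \<A> g \<gamma> t = sqrt (g c (\<gamma> t) w w)"
proof -
  define c' where "c' = (SOME c. c \<in> \<A> \<and> \<gamma> t \<in> fst c)"
  have c': "c' \<in> \<A>" "\<gamma> t \<in> fst c'"
    using someI[of "\<lambda>c. c \<in> \<A> \<and> \<gamma> t \<in> fst c" c] c by (auto simp: c'_def)
  let ?D = "frechet_derivative (transition c c') (at (snd c (\<gamma> t)))"
  have "((transition c c' \<circ> (snd c \<circ> \<gamma>)) has_vector_derivative ?D w) (at t)"
    using vector_derivative_diff_chain_within[OF w, of "transition c c'" ?D]
      transition_derivative(1)[OF A c(1) c'(1), of "\<gamma> t"] c c'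
    by (auto intro: has_derivative_at_withinI)
  moreover obtain T where T: "open T" "t \<in> T" "\<And>s. s \<in> T \<Longrightarrow> \<gamma> s \<in> fst c"
    using isCont_open_nhd[OF cont open_chart_domain[OF A c(1)] c(2)] by metis
  have "\<And>s. s \<in> T \<Longrightarrow> (transition c c' \<circ> (snd c \<circ> \<gamma>)) s = (snd c' \<circ> \<gamma>) s"
    using T inj_on_chart[OF A c(1)] by (simp add: transition_def)
  ultimately have "((snd c' \<circ> \<gamma>) has_vector_derivative ?D w) (at t)"
    using has_vector_derivative_transform_within_open T by blast
  moreover have "at t within {0..1} = at t"
    using t by (intro at_within_interior) auto
  ultimately have "vector_derivative (snd c' \<circ> \<gamma>) (at t within {0..1}) = ?D w"
    by (simp add: vector_derivative_at)
  moreover have "g c (\<gamma> t) w w = g c' (\<gamma> t) (?D w) (?D w)"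
    using g c c' unfolding riemannian_metric_def by blast
  ultimately show ?thesis
    by (simp add: curve_speed_def Let_def flip: c'_def)
qed

lemma C1_curve_on_affine:
  assumes \<gamma>: "C1_curve_on \<A> I \<gamma>"
    and I: "\<And>t. t \<in> J \<Longrightarrow> l * t + k \<in> I"
    and eq: "\<And>t. t \<in> J \<Longrightarrow> \<eta> t = \<gamma> (l * t + k)"
  shows "C1_curve_on \<A> J \<eta>"
  unfolding C1_curve_on_def
proof
  fix c assume "c \<in> \<A>"
  let ?I = "{t \<in> I. \<gamma> t \<in> fst c}" and ?J = "{t \<in> J. \<eta> t \<in> fst c}"
  obtain D where D: "continuous_on ?I D"
      "\<And>t. t \<in> ?I \<Longrightarrow> ((snd c \<circ> \<gamma>) has_vector_derivative D t) (at t within ?I)"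
    using \<gamma> \<open>c \<in> \<A>\<close> unfolding C1_curve_on_def by blast
  have sub: "(\<lambda>t. l * t + k) ` ?J \<subseteq> ?I"
    using I eq by auto
  have "continuous_on ?J (\<lambda>t. l *\<^sub>R D (l * t + k))"
    using sub by (intro continuous_intros continuous_on_compose2[OF D(1)]) auto
  moreover have "((snd c \<circ> \<eta>) has_vector_derivative l *\<^sub>R D (l * t + k)) (at t within ?J)" if "t \<in> ?J" for t
  proof -
    have "((\<lambda>t. l * t + k) has_vector_derivative l) (at t within ?J)"
      by (auto intro!: derivative_eq_intros)
    moreover have "((snd c \<circ> \<gamma>) has_vector_derivative D (l * t + k)) (at (l * t + k) within (\<lambda>t. l * t + k) ` ?J)"
      using D(2) sub that has_vector_derivative_within_subset by blast
    ultimately have "((snd c \<circ> \<gamma>) \<circ> (\<lambda>t. l * t + k) has_vector_derivative l *\<^sub>R D (l * t + k)) (at t within ?J)"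
      by (rule vector_diff_chain_within)
    then show ?thesis
      by (rule has_vector_derivative_transform[OF that, rotated]) (auto simp: eq)
  qed
  ultimately show "\<exists>D. continuous_on ?J D \<and>
      (\<forall>t\<in>?J. ((snd c \<circ> \<eta>) has_vector_derivative D t) (at t within ?J))"
    by blast
qed

lemma piecewise_C1_curve_isCont:
  assumes "piecewise_C1_curve \<A> \<gamma>" "0 < t" "t < 1"
  shows "isCont \<gamma> t"
  using assms continuous_on_interior[of "{0..1}" \<gamma> t] by (auto simp: piecewise_C1_curve_def)

lemma piecewise_C1_curve_has_vector_derivative:
  assumes A: "smooth_atlas \<A>" and \<gamma>: "piecewise_C1_curve \<A> \<gamma>"
  obtains S where "finite S"
    and "\<And>t c. \<lbrakk>0 < t; t < 1; t \<notin> S; c \<in> \<A>; \<gamma> t \<in> fst c\<rbrakk> \<Longrightarrow>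
           \<exists>w. ((snd c \<circ> \<gamma>) has_vector_derivative w) (at t)"
proof -
  obtain S where S: "finite S"
    "\<And>a b. 0 \<le> a \<Longrightarrow> a < b \<Longrightarrow> b \<le> 1 \<Longrightarrow> {a<..<b} \<inter> S = {} \<Longrightarrow> C1_curve_on \<A> {a..b} \<gamma>"
    using \<gamma> unfolding piecewise_C1_curve_def by blast
  show thesis
  proof (rule that[OF S(1)])
    fix t c assume t: "0 < t" "t < 1" "t \<notin> S" and c: "c \<in> \<A>" "\<gamma> t \<in> fst c"
    have "open ({0<..<1} - S)"
      using S(1) by (simp add: finite_imp_closed open_Diff)
    then obtain e where e: "e > 0" "ball t e \<subseteq> {0<..<1} - S"
      using t openE[of "{0<..<1} - S" t] by auto
    define a b where "a = t - e / 2" and "b = t + e / 2"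
    have "cball t (e / 2) \<subseteq> ball t e"
      using e(1) by auto
    then have ab: "{a..b} \<subseteq> {0<..<1} - S"
      using e(2) by (simp add: a_def b_def cball_eq_atLeastAtMost)
    have tab: "a < t" "t < b"
      using e(1) by (auto simp: a_def b_def)
    have "0 \<le> a" "b \<le> 1" "{a<..<b} \<inter> S = {}"
      using ab tab by (auto simp: subset_iff intro: less_imp_le)
    then have "C1_curve_on \<A> {a..b} \<gamma>"
      using S(2) tab by simp
    then obtain w where w: "((snd c \<circ> \<gamma>) has_vector_derivative w) (at t within {t \<in> {a..b}. \<gamma> t \<in> fst c})"
      using c tab unfolding C1_curve_on_def by fastforce
    obtain T where T: "open T" "t \<in> T" "\<And>s. s \<in> T \<Longrightarrow> \<gamma> s \<in> fst c"
      using isCont_open_nhd[OF piecewise_C1_curve_isCont[OF \<gamma> t(1,2)] open_chart_domain[OF A c(1)] c(2)]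
      by metis
    have "t \<in> interior {t \<in> {a..b}. \<gamma> t \<in> fst c}"
      using T tab by (intro interiorI[of "T \<inter> {a<..<b}"]) auto
    then show "\<exists>w. ((snd c \<circ> \<gamma>) has_vector_derivative w) (at t)"
      using w at_within_interior by metis
  qed
qed

lemma curve_speed_affine:
  assumes A: "smooth_atlas \<A>" and g: "riemannian_metric \<A> g" and \<gamma>: "piecewise_C1_curve \<A> \<gamma>"
    and l: "l > 0"
    and T: "open T" "\<And>t. t \<in> T \<Longrightarrow> 0 < t \<and> t < 1 \<and> 0 < l * t + k \<and> l * t + k < 1"
    and eq: "\<And>t. t \<in> T \<Longrightarrow> \<eta> t = \<gamma> (l * t + k)"
  obtains S where "finite S"
    and "\<And>t. t \<in> T - S \<Longrightarrow> curve_speed \<A> g \<eta> t = l * curve_speed \<A> g \<gamma> (l * t + k)"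
proof -
  obtain S where S: "finite S"
    "\<And>t c. \<lbrakk>0 < t; t < 1; t \<notin> S; c \<in> \<A>; \<gamma> t \<in> fst c\<rbrakk> \<Longrightarrow>
           \<exists>w. ((snd c \<circ> \<gamma>) has_vector_derivative w) (at t)"
    using piecewise_C1_curve_has_vector_derivative[OF A \<gamma>] by blast
  have "inj (\<lambda>t. l * t + k)"
    using l by (auto simp: inj_on_def)
  show thesis
  proof (rule that)
    show "finite ((\<lambda>t. l * t + k) -` S)"
      by (rule finite_vimageI) fact+
    fix t assume t: "t \<in> T - (\<lambda>t. l * t + k) -` S"
    define s where "s = l * t + k"
    have s: "0 < s" "s < 1" "s \<notin> S" and t': "t \<in> T" "0 < t" "t < 1"
      using t T(2) by (auto simp: s_def)
    obtain c where c: "c \<in> \<A>" "\<gamma> s \<in> fst c"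
      using chart_at_exists[OF A] by blast
    then obtain w where w: "((snd c \<circ> \<gamma>) has_vector_derivative w) (at s)"
      using S(2) s by blast
    have "((\<lambda>t. l * t + k) has_vector_derivative l) (at t)"
      by (auto intro!: derivative_eq_intros)
    then have "((snd c \<circ> \<gamma>) \<circ> (\<lambda>t. l * t + k) has_vector_derivative l *\<^sub>R w) (at t)"
      by (rule vector_diff_chain_at) (use w in \<open>simp add: s_def\<close>)
    then have w': "((snd c \<circ> \<eta>) has_vector_derivative l *\<^sub>R w) (at t)"
      by (rule has_vector_derivative_transform_within_open[OF _ T(1) t'(1)]) (simp add: eq)
    have contg: "isCont \<gamma> s"
      using s by (intro piecewise_C1_curve_isCont[OF \<gamma>])
    have "isCont (\<gamma> \<circ> (\<lambda>t. l * t + k)) t"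
      unfolding comp_def by (rule continuous_within_compose3[of _ _ \<gamma>], use contg in \<open>simp add: s_def\<close>) (intro continuous_intros)
    moreover have "\<forall>\<^sub>F x in nhds t. \<eta> x = (\<gamma> \<circ> (\<lambda>t. l * t + k)) x"
      using eventually_nhds_in_open[OF T(1) t'(1)] by eventually_elim (simp add: eq)
    ultimately have contn: "isCont \<eta> t"
      by (simp add: isCont_cong comp_def)
    have [simp]: "\<eta> t = \<gamma> s"
      using eq t'(1) by (simp add: s_def)
    have "bilinear (g c (\<gamma> s))"
      using g c unfolding riemannian_metric_def by blast
    then have "g c (\<gamma> s) (l *\<^sub>R w) (l *\<^sub>R w) = l\<^sup>2 * g c (\<gamma> s) w w"
      by (simp add: bilinear_lmul bilinear_rmul power2_eq_square)
    then have "curve_speed \<A> g \<eta> t = l * sqrt (g c (\<gamma> s) w w)"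
      using curve_speed_eq[OF A g c(1) _ t'(2,3) contn w'] c(2) l by (simp add: real_sqrt_mult)
    also have "sqrt (g c (\<gamma> s) w w) = curve_speed \<A> g \<gamma> s"
      using curve_speed_eq[OF A g c s(1,2) contg w] by simp
    finally show "curve_speed \<A> g \<eta> t = l * curve_speed \<A> g \<gamma> (l * t + k)"
      by (simp add: s_def)
  qed
qed

lemma piecewise_C1_curve_join:
  assumes \<gamma>1: "piecewise_C1_curve \<A> \<gamma>1" and \<gamma>2: "piecewise_C1_curve \<A> \<gamma>2" and eq: "\<gamma>1 1 = \<gamma>2 0"
  shows "piecewise_C1_curve \<A> (\<gamma>1 +++ \<gamma>2)"
proof -
  obtain S1 where S1: "finite S1"
    "\<And>a b. 0 \<le> a \<Longrightarrow> a < b \<Longrightarrow> b \<le> 1 \<Longrightarrow> {a<..<b} \<inter> S1 = {} \<Longrightarrow> C1_curve_on \<A> {a..b} \<gamma>1"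
    using \<gamma>1 unfolding piecewise_C1_curve_def by blast
  obtain S2 where S2: "finite S2"
    "\<And>a b. 0 \<le> a \<Longrightarrow> a < b \<Longrightarrow> b \<le> 1 \<Longrightarrow> {a<..<b} \<inter> S2 = {} \<Longrightarrow> C1_curve_on \<A> {a..b} \<gamma>2"
    using \<gamma>2 unfolding piecewise_C1_curve_def by blast
  define S where "S = insert (1/2) ((\<lambda>t. 2 * t) -` S1 \<union> (\<lambda>t. 2 * t - 1) -` S2)"
  have "path (\<gamma>1 +++ \<gamma>2)"
    using \<gamma>1 \<gamma>2 eq
    by (intro path_join_imp) (simp_all add: path_def pathstart_def pathfinish_def piecewise_C1_curve_def)
  then have "continuous_on {0..1} (\<gamma>1 +++ \<gamma>2)"
    by (simp add: path_def)
  moreover have "finite S"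
    unfolding S_def using S1(1) S2(1) by (auto intro!: finite_vimageI simp: inj_on_def)
  moreover have "C1_curve_on \<A> {a..b} (\<gamma>1 +++ \<gamma>2)"
    if ab: "0 \<le> a" "a < b" "b \<le> 1" and disj: "{a<..<b} \<inter> S = {}" for a b
  proof (cases "b \<le> 1/2")
    case True
    have "{2 * a<..<2 * b} \<inter> S1 = {}"
    proof (intro equals0I)
      fix s assume "s \<in> {2 * a<..<2 * b} \<inter> S1"
      then have "s / 2 \<in> {a<..<b} \<inter> S"
        by (auto simp: S_def)
      with disj show False by blast
    qed
    then have "C1_curve_on \<A> {2 * a..2 * b} \<gamma>1"
      using S1(2)[of "2 * a" "2 * b"] ab True by simp
    then show ?thesis
      by (rule C1_curve_on_affine[where l = 2 and k = 0]) (use True in \<open>auto simp: joinpaths_def\<close>)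
  next
    case False
    have a: "1/2 \<le> a"
      using disj False by (force simp: S_def)
    have "{2 * a - 1<..<2 * b - 1} \<inter> S2 = {}"
    proof (intro equals0I)
      fix s assume "s \<in> {2 * a - 1<..<2 * b - 1} \<inter> S2"
      moreover have "2 * ((s + 1) / 2) - 1 = s"
        by (simp add: field_simps)
      ultimately have "(s + 1) / 2 \<in> {a<..<b} \<inter> S"
        by (auto simp: S_def simp del: distrib_left_numeral)
      with disj show False by blast
    qed
    then have C1: "C1_curve_on \<A> {2 * a - 1..2 * b - 1} \<gamma>2"
      using S2(2)[of "2 * a - 1" "2 * b - 1"] ab a by simp
    have "(\<gamma>1 +++ \<gamma>2) t = \<gamma>2 (2 * t + -1)" if "t \<in> {a..b}" for t
    proof (cases "t = 1/2")
      case True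
      show ?thesis
        unfolding True by (simp add: joinpaths_def eq)
    next
      case False
      then have "\<not> t \<le> 1/2"
        using that a by auto
      then show ?thesis
        by (simp add: joinpaths_def)
    qed
    then show ?thesis
      by (rule C1_curve_on_affine[OF C1, where l = 2 and k = "-1", rotated]) auto
  qed
  ultimately show ?thesis
    unfolding piecewise_C1_curve_def by blast
qed

lemma curve_speed_nonneg:
  assumes A: "smooth_atlas \<A>" and g: "riemannian_metric \<A> g"
  shows "0 \<le> curve_speed \<A> g \<gamma> t"
proof -
  define c where "c = (SOME c. c \<in> \<A> \<and> \<gamma> t \<in> fst c)"
  have c: "c \<in> \<A>" "\<gamma> t \<in> fst c"
    using someI_ex[of "\<lambda>c. c \<in> \<A> \<and> \<gamma> t \<in> fst c"] chart_at_exists[OF A] unfolding c_def by blast+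
  then have "bilinear (g c (\<gamma> t))" "\<And>u. u \<noteq> 0 \<Longrightarrow> g c (\<gamma> t) u u > 0"
    using g unfolding riemannian_metric_def by blast+
  then have "g c (\<gamma> t) u u \<ge> 0" for u
    by (metis bilinear_lzero less_imp_le order_refl)
  then show ?thesis
    by (simp add: curve_speed_def Let_def flip: c_def)
qed

lemma curve_length_nonneg:
  assumes "smooth_atlas \<A>" "riemannian_metric \<A> g"
  shows "0 \<le> curve_length \<A> g \<gamma>"
  unfolding curve_length_def
  by (cases "curve_speed \<A> g \<gamma> integrable_on {0..1}")
     (auto intro: integral_nonneg curve_speed_nonneg[OF assms] simp: not_integrable_integral)

lemma integral_half_interval:
  fixes f h :: "real \<Rightarrow> real"
  assumes int: "f integrable_on {a..a + 1/2}" and S: "finite S"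
    and eq: "\<And>t. t \<in> {a<..<a + 1/2} - S \<Longrightarrow> f t = 2 * h (2 * t + - 2 * a)"
  shows "integral {a..a + 1/2} f = integral {0..1} h"
proof -
  let ?I = "integral {a..a + 1/2} f"
  have "(\<lambda>x. 2 * x + - (2 * a)) ` {a..a + 1/2} = {0..1::real}"
    using image_affinity_atLeastAtMost[of 2 "- (2 * a)" a "a + 1/2"] by simp
  then have "((\<lambda>x. f (1/2 * x + a)) has_integral 2 * ?I) {0..1}"
    using has_integral_affinity[of f ?I a "a + 1/2" "1/2" a] int by (simp add: integrable_integral)
  then have "((\<lambda>x. 1/2 * f (1/2 * x + a)) has_integral 1/2 * (2 * ?I)) {0..1}"
    by (rule has_integral_mult_right)
  then have "(h has_integral 1/2 * (2 * ?I)) {0..1}"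
  proof (rule has_integral_spike_finite[rotated 2])
    show "finite ({0, 1} \<union> (\<lambda>x. 1/2 * x + a) -` S)"
      using S by (auto intro!: finite_vimageI simp: inj_on_def)
    fix x assume x: "x \<in> {0..1} - ({0, 1} \<union> (\<lambda>x. 1/2 * x + a) -` S)"
    then have "f (1/2 * x + a) = 2 * h (2 * (1/2 * x + a) + - 2 * a)"
      by (intro eq) auto
    then show "h x = 1/2 * f (1/2 * x + a)"
      by simp
  qed
  then show ?thesis
    by (simp add: integral_unique)
qed

text \<open>If the speed of the joined curve is not integrable, its length is the junk value 0.\<close>

lemma curve_length_join_le:
  assumes A: "smooth_atlas \<A>" and g: "riemannian_metric \<A> g"
    and \<gamma>1: "piecewise_C1_curve \<A> \<gamma>1" and \<gamma>2: "piecewise_C1_curve \<A> \<gamma>2"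
  shows "curve_length \<A> g (\<gamma>1 +++ \<gamma>2) \<le> curve_length \<A> g \<gamma>1 + curve_length \<A> g \<gamma>2"
proof (cases "curve_speed \<A> g (\<gamma>1 +++ \<gamma>2) integrable_on {0..1}")
  case True
  let ?f = "curve_speed \<A> g (\<gamma>1 +++ \<gamma>2)"
  have f: "?f integrable_on {0..0 + 1/2}" "?f integrable_on {1/2..1/2 + 1/2}"
    by (rule integrable_subinterval_real[OF True]; simp)+
  obtain S1 where S1: "finite S1"
    "\<And>t. t \<in> {0<..<1/2} - S1 \<Longrightarrow> ?f t = 2 * curve_speed \<A> g \<gamma>1 (2 * t + 0)"
    by (rule curve_speed_affine[OF A g \<gamma>1, where l = 2 and k = 0 and T = "{0<..<1/2}" and \<eta> = "\<gamma>1 +++ \<gamma>2"])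
       (auto simp: joinpaths_def)
  obtain S2 where S2: "finite S2"
    "\<And>t. t \<in> {1/2<..<1} - S2 \<Longrightarrow> ?f t = 2 * curve_speed \<A> g \<gamma>2 (2 * t + - 1)"
    by (rule curve_speed_affine[OF A g \<gamma>2, where l = 2 and k = "- 1" and T = "{1/2<..<1}" and \<eta> = "\<gamma>1 +++ \<gamma>2"])
       (auto simp: joinpaths_def)
  have "integral {0..0 + 1/2} ?f = curve_length \<A> g \<gamma>1"
    unfolding curve_length_def by (rule integral_half_interval[OF f(1) S1(1)]) (use S1(2) in auto)
  moreover have "integral {1/2..1/2 + 1/2} ?f = curve_length \<A> g \<gamma>2"
    unfolding curve_length_def by (rule integral_half_interval[OF f(2) S2(1)]) (use S2(2) in auto)
  ultimately show ?thesis
    using Henstock_Kurzweil_Integration.integral_combine[of 0 "1/2" 1 ?f] True by (simp add: curve_length_def)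
next
  case False
  then show ?thesis
    using curve_length_nonneg[OF A g, of \<gamma>1] curve_length_nonneg[OF A g, of \<gamma>2]
    by (simp add: curve_length_def not_integrable_integral)
qed

lemma chart_segment_curve:
  assumes A: "smooth_atlas \<A>" and g: "riemannian_metric \<A> g" and c: "c \<in> \<A>"
    and seg: "closed_segment u v \<subseteq> snd c ` fst c"
    and bound: "\<And>y. y \<in> closed_segment u v \<Longrightarrow>
      sqrt (g c (inv_into (fst c) (snd c) y) (v - u) (v - u)) \<le> K"
  defines "\<gamma> \<equiv> inv_into (fst c) (snd c) \<circ> linepath u v"
  shows "piecewise_C1_curve \<A> \<gamma>" and "0 \<le> K \<Longrightarrow> curve_length \<A> g \<gamma> \<le> K"
proof -
  have line: "linepath u v t \<in> snd c ` fst c" "linepath u v t \<in> closed_segment u v" if "t \<in> {0..1}" for t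
    using that seg linepath_in_path by (auto simp: linepath_image_01[symmetric])
  have \<gamma>: "\<gamma> t \<in> fst c" "snd c (\<gamma> t) = linepath u v t" if "t \<in> {0..1}" for t
    using line(1)[OF that] by (auto simp: \<gamma>_def inv_into_into f_inv_into_f)
  have cont: "continuous_on {0..1} \<gamma>"
    unfolding \<gamma>_def using line
    by (intro continuous_on_compose continuous_on_linepath
        continuous_on_subset[OF continuous_on_chart_inverse[OF A c]]) auto
  show C1: "piecewise_C1_curve \<A> \<gamma>"
  proof -
    have "C1_curve_on \<A> {a..b} \<gamma>" if ab: "0 \<le> a" "b \<le> 1" for a b
      unfolding C1_curve_on_def
    proof
      fix c' assume c': "c' \<in> \<A>"
      let ?J = "{t \<in> {a..b}. \<gamma> t \<in> fst c'}"
      let ?D = "\<lambda>y. frechet_derivative (transition c c') (at y)"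
      have J: "t \<in> {0..1}" "\<gamma> t \<in> fst c \<inter> fst c'" if "t \<in> ?J" for t
        using that ab \<gamma>(1)[of t] by auto
      have "linepath u v t \<in> snd c ` (fst c \<inter> fst c')" if "t \<in> ?J" for t
        using imageI[OF J(2)[OF that], of "snd c"] \<gamma>(2)[OF J(1)[OF that]] by simp
      then have "linepath u v ` ?J \<subseteq> snd c ` (fst c \<inter> fst c')"
        by blast
      then have "continuous_on ?J (\<lambda>t. ?D (linepath u v t) (v - u))"
        by (intro continuous_on_compose2[OF transition_derivative(2)[OF A c c', of "v - u"]]
            continuous_on_linepath)
      moreover have "((snd c' \<circ> \<gamma>) has_vector_derivative ?D (linepath u v t) (v - u)) (at t within ?J)"
        if t: "t \<in> ?J" for t
      proof -
        have "(transition c c' has_derivative ?D (linepath u v t)) (at (linepath u v t))"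
          using transition_derivative(1)[OF A c c' J(2)[OF t]] \<gamma>(2)[OF J(1)[OF t]] by simp
        then have "((transition c c' \<circ> linepath u v) has_vector_derivative ?D (linepath u v t) (v - u)) (at t within ?J)"
          by (rule vector_derivative_diff_chain_within[OF has_vector_derivative_linepath_within
                has_derivative_at_withinI])
        moreover have "transition c c' \<circ> linepath u v = snd c' \<circ> \<gamma>"
          by (simp add: transition_def \<gamma>_def comp_assoc)
        ultimately show ?thesis by simp
      qed
      ultimately show "\<exists>D. continuous_on ?J D \<and>
          (\<forall>t\<in>?J. ((snd c' \<circ> \<gamma>) has_vector_derivative D t) (at t within ?J))"
        by (intro exI[of _ "\<lambda>t. ?D (linepath u v t) (v - u)"]) blast
    qed
    then show ?thesis
      unfolding piecewise_C1_curve_def using cont by (intro conjI exI[of _ "{}"]) auto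
  qed
  assume K: "0 \<le> K"
  have speed: "curve_speed \<A> g \<gamma> t \<le> K" if t: "t \<in> {0<..<1}" for t
  proof -
    have t01: "t \<in> {0..1}"
      using t by auto
    have "(linepath u v has_vector_derivative (v - u)) (at t)"
      by (rule has_vector_derivative_linepath_within)
    then have "((snd c \<circ> \<gamma>) has_vector_derivative (v - u)) (at t)"
      by (rule has_vector_derivative_transform_within_open[of _ _ _ "{0<..<1}"]) (use t \<gamma>(2) in auto)
    then have "curve_speed \<A> g \<gamma> t = sqrt (g c (\<gamma> t) (v - u) (v - u))"
      using t by (intro curve_speed_eq[where \<gamma> = \<gamma>, OF A g c \<gamma>(1)[OF t01]] piecewise_C1_curve_isCont[OF C1]) auto
    then show ?thesis
      using bound line(2)[OF t01] by (simp add: \<gamma>_def)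
  qed
  show "curve_length \<A> g \<gamma> \<le> K"
  proof (cases "curve_speed \<A> g \<gamma> integrable_on {0..1}")
    case True
    then have "curve_speed \<A> g \<gamma> integrable_on {0<..<1}"
      by (simp add: integrable_on_open_interval_real)
    moreover have "((\<lambda>_. K) has_integral K) {0<..<1::real}"
      using has_integral_const_real[of K 0 1] by (simp add: has_integral_Icc_iff_Ioo)
    ultimately have "integral {0<..<1} (curve_speed \<A> g \<gamma>) \<le> K"
      using speed by (rule has_integral_le[OF integrable_integral])
    then show ?thesis
      by (simp add: curve_length_def integral_open_interval_real)
  next
    case False
    then show ?thesis
      using K by (simp add: curve_length_def not_integrable_integral)
  qed
qed

lemma bilinear_diagonal_bound:
  fixes B :: "'a::euclidean_space \<Rightarrow> 'a \<Rightarrow> real"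
  assumes B: "bilinear B" and b: "\<And>i j. i \<in> Basis \<Longrightarrow> j \<in> Basis \<Longrightarrow> \<bar>B i j\<bar> \<le> b i j"
  shows "B w w \<le> (\<Sum>(i, j)\<in>Basis \<times> Basis. b i j) * (norm w)\<^sup>2"
proof -
  have "B w w = B (\<Sum>i\<in>Basis. (w \<bullet> i) *\<^sub>R i) (\<Sum>i\<in>Basis. (w \<bullet> i) *\<^sub>R i)"
    by (simp add: euclidean_representation)
  also have "\<dots> = (\<Sum>(i, j)\<in>Basis \<times> Basis. (w \<bullet> i) * ((w \<bullet> j) * B i j))"
    by (simp add: bilinear_sum[OF B] bilinear_lmul[OF B] bilinear_rmul[OF B] mult.left_commute)
  also have "\<dots> \<le> (\<Sum>(i, j)\<in>Basis \<times> Basis. b i j * (norm w)\<^sup>2)"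
  proof (rule sum_mono, clarify)
    fix i j :: 'a assume ij: "i \<in> Basis" "j \<in> Basis"
    have "(w \<bullet> i) * ((w \<bullet> j) * B i j) \<le> \<bar>w \<bullet> i\<bar> * (\<bar>w \<bullet> j\<bar> * \<bar>B i j\<bar>)"
      by (metis abs_ge_self abs_mult)
    also have "\<dots> \<le> norm w * (norm w * b i j)"
      using ij by (intro mult_mono Basis_le_norm b) auto
    finally show "(w \<bullet> i) * ((w \<bullet> j) * B i j) \<le> b i j * (norm w)\<^sup>2"
      by (simp add: power2_eq_square mult_ac)
  qed
  finally show ?thesis
    by (simp add: sum_distrib_right case_prod_beta)
qed

lemma short_curves_exist:
  assumes A: "smooth_atlas \<A>" and g: "riemannian_metric \<A> g" and e: "0 < e"
  obtains V where "open V" "x \<in> V"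
    and "\<And>y z. y \<in> V \<Longrightarrow> z \<in> V \<Longrightarrow>
      \<exists>\<gamma>. piecewise_C1_curve \<A> \<gamma> \<and> \<gamma> 0 = y \<and> \<gamma> 1 = z \<and> curve_length \<A> g \<gamma> < e"
proof -
  obtain c where c: "c \<in> \<A>" "x \<in> fst c"
    using chart_at_exists[OF A] by blast
  let ?W = "snd c ` fst c" and ?\<psi> = "inv_into (fst c) (snd c)"
  define b where "b i j = \<bar>g c x i j\<bar> + 1" for i j
  define C where "C = (\<Sum>(i, j)\<in>Basis \<times> Basis. b i j)"
  have C: "0 \<le> C"
    unfolding C_def b_def by (intro sum_nonneg) auto
  have W: "open ?W" "snd c x \<in> ?W"
    using open_chart_image[OF A c(1)] c(2) by auto
  have \<psi>: "?\<psi> (snd c y) = y" if "y \<in> fst c" for y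
    using inj_on_chart[OF A c(1)] that by simp
  have "\<forall>\<^sub>F y in nhds (snd c x). \<bar>g c (?\<psi> y) i j\<bar> < b i j" for i j
  proof -
    have "Ck_on 0 (\<lambda>y. g c (?\<psi> y) i j) ?W"
      using g c(1) unfolding riemannian_metric_def smooth_on_def by blast
    then have "continuous_on ?W (\<lambda>y. g c (?\<psi> y) i j)"
      by simp
    then have "isCont (\<lambda>y. g c (?\<psi> y) i j) (snd c x)"
      by (rule bspec[OF iffD1[OF continuous_on_eq_continuous_at[OF W(1)]] W(2)])
    then have "((\<lambda>y. g c (?\<psi> y) i j) \<longlongrightarrow> g c (?\<psi> (snd c x)) i j) (nhds (snd c x))"
      unfolding isCont_def by (rule tendsto_at_iff_tendsto_nhds[THEN iffD1])
    then have "((\<lambda>y. \<bar>g c (?\<psi> y) i j\<bar>) \<longlongrightarrow> \<bar>g c (?\<psi> (snd c x)) i j\<bar>) (nhds (snd c x))"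
      by (rule tendsto_rabs)
    then show ?thesis
      by (rule order_tendstoD) (simp add: b_def \<psi> c(2))
  qed
  then have "\<forall>\<^sub>F y in nhds (snd c x). y \<in> ?W \<and> (\<forall>i\<in>Basis. \<forall>j\<in>Basis. \<bar>g c (?\<psi> y) i j\<bar> < b i j)"
    using W by (intro eventually_conj eventually_ball_finite ballI eventually_nhds_in_open) auto
  then obtain r where r: "r > 0" "\<And>y. dist y (snd c x) < r \<Longrightarrow> y \<in> ?W"
    "\<And>y i j. dist y (snd c x) < r \<Longrightarrow> i \<in> Basis \<Longrightarrow> j \<in> Basis \<Longrightarrow> \<bar>g c (?\<psi> y) i j\<bar> < b i j"
    unfolding eventually_nhds_metric by blast
  define s where "s = min r (e / (2 * (sqrt C + 1)))"
  have d: "0 < 2 * (sqrt C + 1)"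
    using C by (simp add: add_nonneg_pos)
  then have s: "0 < s" "s \<le> r"
    using e r(1) by (auto simp: s_def)
  have "s \<le> e / (2 * (sqrt C + 1))"
    by (simp add: s_def)
  then have se: "s * (2 * (sqrt C + 1)) \<le> e"
    by (simp only: pos_le_divide_eq[OF d])
  define V where "V = fst c \<inter> snd c -` ball (snd c x) s"
  show thesis
  proof (rule that)
    show "open V"
      unfolding V_def
      by (rule continuous_open_preimage[OF continuous_on_chart[OF A c(1)] open_chart_domain[OF A c(1)]]) simp
    show "x \<in> V"
      using c(2) s(1) by (simp add: V_def)
    fix y z assume yz: "y \<in> V" "z \<in> V"
    let ?u = "snd c y" and ?v = "snd c z"
    have uv: "?u \<in> ball (snd c x) s" "?v \<in> ball (snd c x) s" "y \<in> fst c" "z \<in> fst c"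
      using yz by (auto simp: V_def)
    have "dist ?u ?v < 2 * s"
      using uv(1,2) dist_triangle_less_add[of ?u "snd c x" s ?v s] by (simp add: dist_commute)
    then have norm: "norm (?v - ?u) \<le> 2 * s"
      by (simp add: dist_norm norm_minus_commute)
    have seg: "dist w (snd c x) < r" if "w \<in> closed_segment ?u ?v" for w
      using closed_segment_subset[OF uv(1,2) convex_ball] that s(2) by (auto simp: dist_commute)
    have "sqrt (g c (?\<psi> w) (?v - ?u) (?v - ?u)) \<le> sqrt C * (2 * s)" if w: "w \<in> closed_segment ?u ?v" for w
    proof -
      have "?\<psi> w \<in> fst c"
        using r(2)[OF seg[OF w]] by (rule inv_into_into)
      then have "bilinear (g c (?\<psi> w))"
        using g c(1) unfolding riemannian_metric_def by blast
      then have "g c (?\<psi> w) (?v - ?u) (?v - ?u) \<le> C * (norm (?v - ?u))\<^sup>2"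
        unfolding C_def by (rule bilinear_diagonal_bound) (use r(3)[OF seg[OF w]] in \<open>simp add: less_imp_le\<close>)
      then have "sqrt (g c (?\<psi> w) (?v - ?u) (?v - ?u)) \<le> sqrt C * norm (?v - ?u)"
        using real_sqrt_le_mono by (fastforce simp: real_sqrt_mult)
      also have "\<dots> \<le> sqrt C * (2 * s)"
        using norm C by (intro mult_left_mono) auto
      finally show ?thesis .
    qed
    note * = chart_segment_curve[OF A g c(1) _ this]
    let ?\<gamma> = "?\<psi> \<circ> linepath ?u ?v"
    have "closed_segment ?u ?v \<subseteq> ?W"
      using seg r(2) by blast
    then have "piecewise_C1_curve \<A> ?\<gamma>" "curve_length \<A> g ?\<gamma> \<le> sqrt C * (2 * s)"
      using * C s(1) by auto
    moreover have "sqrt C * (2 * s) < e"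
      using se s(1) by (simp add: algebra_simps)
    moreover have "?\<gamma> 0 = y" "?\<gamma> 1 = z"
      using \<psi> uv by (auto simp: linepath_def)
    ultimately show "\<exists>\<gamma>. piecewise_C1_curve \<A> \<gamma> \<and> \<gamma> 0 = y \<and> \<gamma> 1 = z \<and> curve_length \<A> g \<gamma> < e"
      by (intro exI[of _ ?\<gamma>]) auto
  qed
qed

lemma open_geodesic_dist_less:
  assumes A: "smooth_atlas \<A>" and g: "riemannian_metric \<A> g"
  shows "open {y. geodesic_dist \<A> g p y < a}"
proof -
  define L where "L y = {curve_length \<A> g \<gamma> |\<gamma>. piecewise_C1_curve \<A> \<gamma> \<and> \<gamma> 0 = p \<and> \<gamma> 1 = y}" for y
  have dist: "geodesic_dist \<A> g p y = Inf (L y)" for y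
    by (simp add: geodesic_dist_def L_def)
  have bdd: "bdd_below (L y)" for y
    using curve_length_nonneg[OF A g] by (auto simp: L_def intro!: bdd_belowI[of _ 0])
  have extend: "\<exists>l'\<in>L z. l' < l + e"
    if l: "l \<in> L y" and \<eta>: "piecewise_C1_curve \<A> \<eta>" "\<eta> 0 = y" "\<eta> 1 = z" "curve_length \<A> g \<eta> < e" for l y z \<eta> e
  proof -
    obtain \<gamma> where \<gamma>: "piecewise_C1_curve \<A> \<gamma>" "\<gamma> 0 = p" "\<gamma> 1 = y" "l = curve_length \<A> g \<gamma>"
      using l unfolding L_def by blast
    have "piecewise_C1_curve \<A> (\<gamma> +++ \<eta>)"
      using piecewise_C1_curve_join[OF \<gamma>(1) \<eta>(1)] \<gamma>(3) \<eta>(2) by simp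
    moreover have "(\<gamma> +++ \<eta>) 0 = p" "(\<gamma> +++ \<eta>) 1 = z"
      using \<gamma> \<eta> by (simp_all add: joinpaths_def)
    ultimately have "curve_length \<A> g (\<gamma> +++ \<eta>) \<in> L z"
      unfolding L_def by blast
    moreover have "curve_length \<A> g (\<gamma> +++ \<eta>) < l + e"
      using curve_length_join_le[OF A g \<gamma>(1) \<eta>(1)] \<eta>(4) \<gamma>(4) by simp
    ultimately show ?thesis by blast
  qed
  have "\<exists>V. open V \<and> y \<in> V \<and> V \<subseteq> {y. geodesic_dist \<A> g p y < a}" if y: "geodesic_dist \<A> g p y < a" for y
  proof (cases "L y = {}")
    case True
    obtain V where V: "open V" "y \<in> V"
      "\<And>y z. y \<in> V \<Longrightarrow> z \<in> V \<Longrightarrow>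
        \<exists>\<gamma>. piecewise_C1_curve \<A> \<gamma> \<and> \<gamma> 0 = y \<and> \<gamma> 1 = z \<and> curve_length \<A> g \<gamma> < 1"
      using short_curves_exist[OF A g zero_less_one] by metis
    have "L z = {}" if "z \<in> V" for z
      using V(3)[OF that V(2)] extend True by blast
    then have "V \<subseteq> {y. geodesic_dist \<A> g p y < a}"
      using y True by (auto simp: dist)
    with V show ?thesis by blast
  next
    case False
    then obtain l where l: "l \<in> L y" "l < a"
      using y cInf_lessD unfolding dist by blast
    then have "0 < a - l" by simp
    obtain V where V: "open V" "y \<in> V"
      "\<And>y z. y \<in> V \<Longrightarrow> z \<in> V \<Longrightarrow>
        \<exists>\<gamma>. piecewise_C1_curve \<A> \<gamma> \<and> \<gamma> 0 = y \<and> \<gamma> 1 = z \<and> curve_length \<A> g \<gamma> < a - l"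
      using short_curves_exist[OF A g \<open>0 < a - l\<close>] by metis
    have "geodesic_dist \<A> g p z < a" if z: "z \<in> V" for z
    proof -
      obtain l' where "l' \<in> L z" "l' < l + (a - l)"
        using V(3)[OF V(2) z] extend[OF l(1)] by blast
      then show ?thesis
        using cInf_lower[OF _ bdd, of l' z] by (simp add: dist)
    qed
    with V show ?thesis by blast
  qed
  then show ?thesis
    by (subst open_subopen) blast
qed

lemma borel_measurable_geodesic_dist:
  assumes "smooth_atlas \<A>" "riemannian_metric \<A> g"
  shows "geodesic_dist \<A> g p \<in> borel_measurable borel"
  by (rule borel_measurableI_less) (simp add: open_geodesic_dist_less[OF assms] borel_open)

subsection \<open>Expectation of the balance quotient\<close>

lemma (in finite_measure) tendsto_integral_bounded:
  fixes f :: "real \<Rightarrow> 'a \<Rightarrow> real"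
  assumes meas: "\<And>t. t \<in> S \<Longrightarrow> f t \<in> borel_measurable M" "g \<in> borel_measurable M"
    and bound: "\<And>t \<omega>. t \<in> S \<Longrightarrow> \<bar>f t \<omega>\<bar> \<le> C"
    and lim: "AE \<omega> in M. ((\<lambda>t. f t \<omega>) \<longlongrightarrow> g \<omega>) (at x within S)"
  shows "((\<lambda>t. \<integral>\<omega>. f t \<omega> \<partial>M) \<longlongrightarrow> (\<integral>\<omega>. g \<omega> \<partial>M)) (at x within S)"
  unfolding tendsto_at_iff_sequentially comp_def
proof (intro allI impI)
  fix X assume X: "\<forall>i. X i \<in> S - {x}" "X \<longlonglongrightarrow> x"
  have "AE \<omega> in M. (\<lambda>i. f (X i) \<omega>) \<longlonglongrightarrow> g \<omega>"
    using lim by eventually_elim (use X in \<open>auto simp: tendsto_at_iff_sequentially comp_def\<close>)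
  then show "(\<lambda>i. \<integral>\<omega>. f (X i) \<omega> \<partial>M) \<longlonglongrightarrow> (\<integral>\<omega>. g \<omega> \<partial>M)"
    using X(1) meas bound by (intro integral_dominated_convergence[where w = "\<lambda>_. C"]) auto
qed

definition balance :: "real \<Rightarrow> real \<Rightarrow> real \<Rightarrow> real" where
  "balance A B \<alpha> = (\<alpha> * A - (2 - \<alpha>) * B) / (\<alpha> * A + (2 - \<alpha>) * B)"

lemma balance_denominator_pos:
  fixes A B \<alpha> :: real
  assumes "0 < A" "0 < B" "\<alpha> \<in> {0..2}"
  shows "0 < \<alpha> * A + (2 - \<alpha>) * B"
  using assms by (cases "\<alpha> = 0") (auto intro: add_pos_nonneg)

lemma abs_balance_le_1:
  assumes "0 \<le> A" "0 \<le> B" "\<alpha> \<in> {0..2}"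
  shows "\<bar>balance A B \<alpha>\<bar> \<le> 1"
proof -
  have *: "\<bar>x - y\<bar> / (x + y) \<le> 1" if "0 \<le> x" "0 \<le> y" for x y :: real
    using that by (auto simp: divide_le_eq_1)
  have "0 \<le> \<alpha> * A" "0 \<le> (2 - \<alpha>) * B"
    using assms by auto
  then show ?thesis
    using *[of "\<alpha> * A" "(2 - \<alpha>) * B"] by (simp add: balance_def)
qed

lemma continuous_on_balance:
  assumes "0 < A" "0 < B"
  shows "continuous_on {0..2} (balance A B)"
  unfolding balance_def[abs_def]
  using balance_denominator_pos[OF assms] by (intro continuous_intros) (metis less_irrefl)

lemma balance_strict_mono:
  assumes "0 < A" "0 < B" "\<alpha> \<in> {0..2}" "\<beta> \<in> {0..2}" "\<alpha> < \<beta>"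
  shows "balance A B \<alpha> < balance A B \<beta>"
proof -
  let ?n = "\<lambda>\<alpha>. \<alpha> * A - (2 - \<alpha>) * B" and ?d = "\<lambda>\<alpha>. \<alpha> * A + (2 - \<alpha>) * B"
  have "?n \<beta> * ?d \<alpha> - ?n \<alpha> * ?d \<beta> = 4 * (\<beta> - \<alpha>) * (A * B)"
    by (simp add: algebra_simps)
  moreover have "0 < 4 * (\<beta> - \<alpha>) * (A * B)"
    using assms by simp
  ultimately have "?n \<alpha> * ?d \<beta> < ?n \<beta> * ?d \<alpha>"
    by linarith
  moreover have "0 < ?d \<alpha>" "0 < ?d \<beta>"
    using assms by (intro balance_denominator_pos; simp)+
  ultimately show ?thesis
    unfolding balance_def by (simp only: pos_divide_less_eq pos_less_divide_eq times_divide_eq_left)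
qed

lemma balance_endpoints:
  assumes "0 < A" "0 < B"
  shows "balance A B 0 = -1" "balance A B 2 = 1"
  using assms by (auto simp: balance_def)

text \<open>The integrals extend continuously to the closed interval, where dominated convergence
  applies at the end points as well.\<close>

lemma (in prob_space) expectation_balance:
  fixes A B :: "'a \<Rightarrow> real"
  assumes meas [measurable]: "A \<in> borel_measurable M" "B \<in> borel_measurable M"
    and nonneg: "\<And>\<omega>. 0 \<le> A \<omega>" "\<And>\<omega>. 0 \<le> B \<omega>"
    and pos: "AE \<omega> in M. 0 < A \<omega>" "AE \<omega> in M. 0 < B \<omega>"
  defines "H \<equiv> \<lambda>\<alpha>. \<integral>\<omega>. balance (A \<omega>) (B \<omega>) \<alpha> \<partial>M"
  shows continuous_on_expectation_balance: "continuous_on {0..2} H"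
    and strict_mono_on_expectation_balance: "strict_mono_on {0..2} H"
    and expectation_balance_0: "H 0 = -1"
    and expectation_balance_2: "H 2 = 1"
proof -
  have pos': "AE \<omega> in M. 0 < A \<omega> \<and> 0 < B \<omega>"
    using pos by eventually_elim simp
  have meas_balance [measurable]: "(\<lambda>\<omega>. balance (A \<omega>) (B \<omega>) \<alpha>) \<in> borel_measurable M" for \<alpha>
    unfolding balance_def by measurable
  show "continuous_on {0..2} H"
    unfolding continuous_on_def H_def
  proof
    fix x :: real assume x: "x \<in> {0..2}"
    show "((\<lambda>\<alpha>. \<integral>\<omega>. balance (A \<omega>) (B \<omega>) \<alpha> \<partial>M) \<longlongrightarrow> (\<integral>\<omega>. balance (A \<omega>) (B \<omega>) x \<partial>M)) (at x within {0..2})"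
    proof (rule tendsto_integral_bounded)
      show "AE \<omega> in M. (balance (A \<omega>) (B \<omega>) \<longlongrightarrow> balance (A \<omega>) (B \<omega>) x) (at x within {0..2})"
        using pos' by eventually_elim (use continuous_on_balance x in \<open>auto simp: continuous_on_def\<close>)
    qed (use nonneg in \<open>auto intro: abs_balance_le_1\<close>)
  qed
  have integrable: "integrable M (\<lambda>\<omega>. balance (A \<omega>) (B \<omega>) \<alpha>)" if "\<alpha> \<in> {0..2}" for \<alpha>
    using nonneg abs_balance_le_1[OF _ _ that] by (intro integrable_const_bound[of _ 1]) auto
  show "strict_mono_on {0..2} H"
  proof (rule strict_mono_onI)
    fix \<alpha> \<beta> :: real assume *: "\<alpha> \<in> {0..2}" "\<beta> \<in> {0..2}" "\<alpha> < \<beta>"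
    have "AE \<omega> in M. balance (A \<omega>) (B \<omega>) \<alpha> < balance (A \<omega>) (B \<omega>) \<beta>"
      using pos' by eventually_elim (use * balance_strict_mono in blast)
    then show "H \<alpha> < H \<beta>"
      unfolding H_def using * by (intro integral_less_AE_space integrable) (auto simp: emeasure_space_1)
  qed
  have "H 0 = (\<integral>\<omega>. -1 \<partial>M)"
    unfolding H_def using pos' by (intro integral_cong_AE) (auto simp: balance_endpoints)
  then show "H 0 = -1"
    by (simp add: prob_space)
  have "H 2 = (\<integral>\<omega>. 1 \<partial>M)"
    unfolding H_def using pos' by (intro integral_cong_AE) (auto simp: balance_endpoints)
  then show "H 2 = 1"
    by (simp add: prob_space)
qed

theorem theorem21:
  fixes AM :: "('m::{t2_space,second_countable_topology}, 'd::euclidean_space) chart set"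
    and gM :: "('m, 'd) metric_tensor"
    and AN :: "('n::{t2_space,second_countable_topology}, 'e::euclidean_space) chart set"
    and gN :: "('n, 'e) metric_tensor"
    and d\<^sub>M :: "'m \<Rightarrow> 'm \<Rightarrow> real" and d\<^sub>N :: "'n \<Rightarrow> 'n \<Rightarrow> real"
    and W :: "'w measure" and Z :: "'w \<Rightarrow> 'm \<times> 'n"
    and m :: "'m \<times> 'n"
  assumes M: "complete_riemannian_manifold AM gM"
    and N: "complete_riemannian_manifold AN gN"
    and dM: "d\<^sub>M = geodesic_dist AM gM"
    and dN: "d\<^sub>N = geodesic_dist AN gN"
    and W: "prob_space W"
    and Z: "Z \<in> borel_measurable W"
    and A_pos: "\<P>(\<omega> in W. sq_dist_fst d\<^sub>M m (Z \<omega>) > 0) = 1"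
    and B_pos: "\<P>(\<omega> in W. sq_dist_snd d\<^sub>N m (Z \<omega>) > 0) = 1"
    and AB_pos: "\<P>(\<omega> in W. sq_dist_fst d\<^sub>M m (Z \<omega>) * sq_dist_snd d\<^sub>N m (Z \<omega>) > 0) > 0"
  shows "continuous_on {0<..<2} (\<lambda>\<alpha>. H_balance d\<^sub>M d\<^sub>N W Z \<alpha> m) \<and>
    strict_mono_on {0<..<2} (\<lambda>\<alpha>. H_balance d\<^sub>M d\<^sub>N W Z \<alpha> m) \<and>
    ((\<lambda>\<alpha>. H_balance d\<^sub>M d\<^sub>N W Z \<alpha> m) \<longlongrightarrow> -1) (at_right 0) \<and>
    ((\<lambda>\<alpha>. H_balance d\<^sub>M d\<^sub>N W Z \<alpha> m) \<longlongrightarrow> 1) (at_left 2) \<and>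
    (\<exists>!\<alpha>. \<alpha> \<in> {0<..<2} \<and> H_balance d\<^sub>M d\<^sub>N W Z \<alpha> m = 0)"
proof -
  interpret prob_space W by (rule W)
  let ?A = "\<lambda>\<omega>. sq_dist_fst d\<^sub>M m (Z \<omega>)" and ?B = "\<lambda>\<omega>. sq_dist_snd d\<^sub>N m (Z \<omega>)"
  let ?H = "\<lambda>\<alpha>. H_balance d\<^sub>M d\<^sub>N W Z \<alpha> m"
  have "fst \<in> borel_measurable (borel :: ('m \<times> 'n) measure)" "snd \<in> borel_measurable (borel :: ('m \<times> 'n) measure)"
    by (intro borel_measurable_continuous_onI continuous_intros)+
  then have [measurable]: "(\<lambda>\<omega>. fst (Z \<omega>)) \<in> borel_measurable W" "(\<lambda>\<omega>. snd (Z \<omega>)) \<in> borel_measurable W"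
    using measurable_compose[OF Z] by auto
  have [measurable]: "d\<^sub>M p \<in> borel_measurable borel" "d\<^sub>N q \<in> borel_measurable borel" for p q
    using M N unfolding dM dN complete_riemannian_manifold_def
    by (auto intro: borel_measurable_geodesic_dist)
  have meas [measurable]: "?A \<in> borel_measurable W" "?B \<in> borel_measurable W"
    unfolding sq_dist_fst_def sq_dist_snd_def by measurable
  have pos: "AE \<omega> in W. 0 < ?A \<omega>" "AE \<omega> in W. 0 < ?B \<omega>"
    by (rule iffD1[OF prob_Collect_eq_1 A_pos] iffD1[OF prob_Collect_eq_1 B_pos], measurable)+
  have nonneg: "0 \<le> ?A \<omega>" "0 \<le> ?B \<omega>" for \<omega>
    by (simp_all add: sq_dist_fst_def sq_dist_snd_def)
  have H: "?H \<alpha> = (\<integral>\<omega>. balance (?A \<omega>) (?B \<omega>) \<alpha> \<partial>W)" for \<alpha>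
    by (simp add: H_balance_def h_balance_def balance_def)
  have closed: "continuous_on {0..2} ?H" "strict_mono_on {0..2} ?H" "?H 0 = -1" "?H 2 = 1"
    using expectation_balance[OF meas nonneg pos] by (simp_all only: H)
  have "(?H \<longlongrightarrow> ?H 0) (at 0 within {0..2})" "(?H \<longlongrightarrow> ?H 2) (at 2 within {0..2})"
    using closed(1) by (simp_all add: continuous_on_def)
  then have lim0: "(?H \<longlongrightarrow> -1) (at_right 0)" and lim2: "(?H \<longlongrightarrow> 1) (at_left 2)"
    by (simp_all add: closed(3,4) at_within_Icc_at_right at_within_Icc_at_left)
  have cont: "continuous_on {0<..<2} ?H"
    by (rule continuous_on_subset[OF closed(1)]) auto
  have mono: "strict_mono_on {0<..<2} ?H"
    by (rule strict_mono_onI) (use strict_mono_onD[OF closed(2)] in auto)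
  obtain \<alpha> where \<alpha>: "0 \<le> \<alpha>" "\<alpha> \<le> 2" "?H \<alpha> = 0"
    using IVT'[of ?H 0 0 2] closed(1,3,4) by auto
  have "\<alpha> \<noteq> 0" "\<alpha> \<noteq> 2"
    using \<alpha>(3) closed(3,4) by auto
  with \<alpha> have "\<alpha> \<in> {0<..<2} \<and> ?H \<alpha> = 0"
    by auto
  moreover have "\<beta> = \<alpha>" if "\<beta> \<in> {0<..<2} \<and> ?H \<beta> = 0" for \<beta>
    using inj_onD[OF strict_mono_on_imp_inj_on[OF mono], of \<beta> \<alpha>] that calculation by simp
  ultimately have "\<exists>!\<alpha>. \<alpha> \<in> {0<..<2} \<and> ?H \<alpha> = 0"
    by blast
  with cont mono lim0 lim2 show ?thesis
    by blast
qed

end
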